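(* Let $d \ge 1$ and $r \ge d$ be integers, and let $P_1,\dots,P_r \subset \mathbb{R}^d$ be convex polytopes such that $f_0(P_i) \ge d+1$ for all $i = 1,\dots,r$. Then \[ f_0(P_1 + \cdots + P_r) \ \le\ \left(1 - \frac{1}{(d+1)^r}\right)\prod_{i=1}^r f_0(P_i). \]
   Context: For a polytope $P$, $f_0(P)$ denotes its number of vertices. For polytopes $P,Q\subset\mathbb{R}^d$ the Minkowski sum is $P+Q=\{p+q : p\in P,\ q\in Q\}$, and sums of several polytopes are defined iteratively.
   Formalization: The case d = r = 1 is excluded, since there every admissible P_1 is a segment with 2 vertices and the claimed bound would read 2 ≤ 1; all other r ≥ d ≥ 1 are covered. *)

theory Defs
  imports "HOL-Analysis.Analysis" "HOL-Library.Set_Algebras"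
begin

definition f0 :: "'a::real_vector set \<Rightarrow> nat" where
  "f0 P = card {v. v extreme_point_of P}"

text \<open>
  For polytopes \<open>P\<close> in dimension \<open>d\<close>, the bound
  \<open>f0 (P\<^sub>1 + \<dots> + P\<^sub>r) \<le> (1 - 1 / (d + 1)^r) * (f0 P\<^sub>1 * \<dots> * f0 P\<^sub>r)\<close>
  fails in the single case \<open>d = r = 1\<close>, where it reads \<open>f0 P \<le> f0 P / 2\<close>. Hence
  this pair of parameters has to be excluded when the bound is asserted for all \<open>r \<ge> d \<ge> 1\<close>.
\<close>

lemma bound_fails_for_segment:
  fixes P :: "nat \<Rightarrow> (real^1) set"
  defines "P \<equiv> (\<lambda>i. closed_segment 0 1)"
  shows "polytope (P i)" and "f0 (P i) = CARD(1) + 1"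
    and "\<not> real (f0 (\<Sum>i=1..1. P i))
            \<le> (1 - 1 / (real CARD(1) + 1) ^ 1) * (\<Prod>i=1..1. real (f0 (P i)))"
proof -
  have "{v. v extreme_point_of closed_segment 0 (1::real^1)} = {0, 1}"
    by (auto simp: extreme_point_of_segment)
  moreover have "(0::real^1) \<noteq> 1" by simp
  ultimately have 2: "f0 (P i) = 2" for i
    by (simp add: f0_def P_def)
  show "polytope (P i)"
    unfolding P_def segment_convex_hull by (intro polytope_convex_hull) auto
  show "f0 (P i) = CARD(1) + 1" by (simp add: 2)
  show "\<not> real (f0 (\<Sum>i=1..1. P i))
            \<le> (1 - 1 / (real CARD(1) + 1) ^ 1) * (\<Prod>i=1..1. real (f0 (P i)))"
    by (simp add: 2)
qed

end

theory Submission imports Defs begin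

text \<open>
  A vertex of \<open>P\<^sub>1 + \<dots> + P\<^sub>r\<close> is a choice of vertices \<open>v\<^sub>i\<close> of the \<open>P\<^sub>i\<close> for which one linear functional
  has \<open>v\<^sub>i\<close> as its strict maximiser on \<open>P\<^sub>i\<close> for all \<open>i\<close> at once. Let \<open>d \<ge> 2\<close>; then not all choices
  from \<open>d\<close> triples of points \<open>W\<^sub>i\<close> can be of this kind. Pick edge vectors \<open>x\<^sub>i = u\<^sub>i - l\<^sub>i\<close> for \<open>i \<noteq> 1\<close>, a
  nonzero \<open>n\<close> orthogonal to all of them, and a point \<open>q\<close> of \<open>W\<^sub>1\<close> at which \<open>n\<close> takes its median value.
  Some convex combination \<open>x\<^sub>1\<close> of the two vectors from the other points of \<open>W\<^sub>1\<close> to \<open>q\<close> is orthogonal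
  to \<open>n\<close>, so \<open>x\<^sub>1, \<dots>, x\<^sub>d\<close> satisfy a linear relation, with nonnegative first coefficient. A functional
  that is maximal at \<open>q\<close> and, according to the signs of the other coefficients, at \<open>u\<^sub>i\<close> or \<open>l\<^sub>i\<close>
  makes every nonzero term of the relation positive, which is absurd. In dimension 1 two pairs of
  points suffice.
  Hence any product of \<open>(d + 1)\<close>-subsets of the vertex sets contains a choice that is not a
  vertex of the sum; averaging over products of cyclic intervals gives the bound.
\<close>

section \<open>Choices that no functional exposes\<close>

text \<open>Nothing asks that \<open>V i\<close> be convex or contain \<open>t i\<close>, so the
  notion applies alike to polytopes, their vertex sets and subsets of these. Only the values of
  \<open>t\<close> on \<open>I\<close> count.\<close>

definition jointly_exposed :: "'i set \<Rightarrow> ('i \<Rightarrow> 'a::real_inner set) \<Rightarrow> ('i \<Rightarrow> 'a) \<Rightarrow> bool" where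
  "jointly_exposed I V t \<longleftrightarrow> (\<exists>c. \<forall>i\<in>I. \<forall>w\<in>V i - {t i}. c \<bullet> w < c \<bullet> t i)"

lemma jointly_exposed_mono:
  assumes "jointly_exposed I V t" "\<And>i. i \<in> I \<Longrightarrow> W i \<subseteq> V i"
  shows "jointly_exposed I W t"
  using assms unfolding jointly_exposed_def by (meson DiffD1 DiffD2 DiffI subsetD)

text \<open>The relation is indexed by \<open>J\<close>, not by the image, since two indices may
  carry the same vector; such a coincidence is itself a relation, with coefficients 1 and
  -1.\<close>

lemma family_linear_relation:
  fixes x :: "'i \<Rightarrow> 'a::euclidean_space"
  assumes "finite J" "dim (x ` J) < card J"
  obtains a where "(\<Sum>i\<in>J. a i *\<^sub>R x i) = 0" "\<exists>i\<in>J. a i \<noteq> 0"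
proof (cases "inj_on x J")
  case True
  have "dependent (x ` J)"
    using independent_card_le_dim[of "x ` J" "x ` J"] assms(2) card_image[OF True] by force
  then obtain u where u: "\<exists>v\<in>x ` J. u v \<noteq> 0" "(\<Sum>v\<in>x ` J. u v *\<^sub>R v) = 0"
    using dependent_finite[of "x ` J"] assms(1) by auto
  show ?thesis
    using that[of "u \<circ> x"] u sum.reindex[OF True, of "\<lambda>v. u v *\<^sub>R v"] by (auto simp: o_def)
next
  case False
  then obtain i j where ij: "i \<in> J" "j \<in> J" "i \<noteq> j" "x i = x j"
    by (auto simp: inj_on_def)
  define a where "a = (\<lambda>k. if k = i then 1 else if k = j then -1 else (0::real))"
  have "(\<Sum>k\<in>J. a k *\<^sub>R x k) = (\<Sum>k\<in>{i, j}. a k *\<^sub>R x k)"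
    using ij assms(1) by (intro sum.mono_neutral_right) (auto simp: a_def)
  also have "\<dots> = 0" using ij by (simp add: a_def)
  finally have "(\<Sum>k\<in>J. a k *\<^sub>R x k) = 0" .
  moreover have "a i \<noteq> 0" by (simp add: a_def)
  ultimately show ?thesis using that[of a] ij(1) by auto
qed

lemma median_of_three:
  fixes f :: "'a \<Rightarrow> 'b::linorder"
  assumes "3 \<le> card W"
  obtains p q m where "p \<in> W" "q \<in> W" "m \<in> W" "p \<noteq> q" "m \<noteq> q" "f p \<le> f q" "f q \<le> f m"
proof -
  obtain T where "T \<subseteq> W" "card T = 3"
    using assms obtain_subset_with_card_n by metis
  then obtain a b c where abc: "a \<in> W" "b \<in> W" "c \<in> W" "a \<noteq> b" "b \<noteq> c" "a \<noteq> c"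
    by (auto simp: card_3_iff)
  consider "f a \<le> f b" "f b \<le> f c" | "f c \<le> f b" "f b \<le> f a" | "f b \<le> f a" "f a \<le> f c"
    | "f c \<le> f a" "f a \<le> f b" | "f a \<le> f c" "f c \<le> f b" | "f b \<le> f c" "f c \<le> f a"
    by (meson linear)
  then show ?thesis
    using that abc by cases metis+
qed

text \<open>Off \<open>k\<close> a negative coefficient is absorbed by choosing the other end of the
  edge. At \<open>k\<close> only \<open>q\<close> is available, hence \<open>0 \<le> a k\<close>.
  Pairing the relation with an exposing functional then gives 0 as a sum of nonnegative terms, not
  all zero.\<close>

lemma unexposed_choice_of_relation:
  fixes x :: "'i \<Rightarrow> 'a::real_inner"
  assumes "finite J" "J \<subseteq> I" "k \<in> J"
    and u: "\<And>i. i \<in> I \<Longrightarrow> u i \<in> W i"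
    and l: "\<And>i. i \<in> J - {k} \<Longrightarrow> l i \<in> W i \<and> l i \<noteq> u i \<and> x i = u i - l i"
    and q: "q \<in> W k"
    and xk: "\<And>c. (\<And>w. w \<in> W k - {q} \<Longrightarrow> c \<bullet> w < c \<bullet> q) \<Longrightarrow> 0 < c \<bullet> x k"
    and a: "(\<Sum>i\<in>J. a i *\<^sub>R x i) = 0" "\<exists>i\<in>J. a i \<noteq> 0" "0 \<le> a k"
  obtains t where "\<And>i. i \<in> I \<Longrightarrow> t i \<in> W i" "\<not> jointly_exposed I W t"
proof -
  define t where "t = (\<lambda>i. if i = k then q else if i \<in> J \<and> a i < 0 then l i else u i)"
  have "\<not> jointly_exposed I W t"
  proof
    assume "jointly_exposed I W t"
    then obtain c where c: "\<And>i w. i \<in> I \<Longrightarrow> w \<in> W i - {t i} \<Longrightarrow> c \<bullet> w < c \<bullet> t i"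
      unfolding jointly_exposed_def by blast
    have pos: "0 < a i * (c \<bullet> x i)" if i: "i \<in> J" "a i \<noteq> 0" for i
    proof (cases "i = k")
      case True
      then have "0 < c \<bullet> x i"
        using xk c[of k] assms(2,3) by (auto simp: t_def)
      then show ?thesis using True a(3) i(2) by simp
    next
      case False
      then have li: "l i \<in> W i" "l i \<noteq> u i" "x i = u i - l i" and ui: "u i \<in> W i"
        using l[of i] u[of i] i assms(2) by auto
      have iI: "i \<in> I" using i assms(2) by blast
      show ?thesis
      proof (cases "a i < 0")
        case True
        then have "c \<bullet> u i < c \<bullet> l i"
          using c[OF iI, of "u i"] ui li False i(1) by (auto simp: t_def)
        then show ?thesis
          using True li by (simp add: inner_diff_right mult_neg_neg)
      next
        case nn: False
        then have "c \<bullet> l i < c \<bullet> u i"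
          using c[OF iI, of "l i"] li False i(1) by (auto simp: t_def)
        then show ?thesis
          using nn li i(2) by (simp add: inner_diff_right)
      qed
    qed
    have "0 < (\<Sum>i\<in>J. a i * (c \<bullet> x i))"
    proof -
      obtain j where "j \<in> J" "a j \<noteq> 0" using a(2) by blast
      moreover have "0 \<le> a i * (c \<bullet> x i)" if "i \<in> J" for i
        using pos[OF that] by (cases "a i = 0") auto
      ultimately show ?thesis
        using assms(1) pos by (intro sum_pos2[of J j]) auto
    qed
    also have "\<dots> = c \<bullet> (\<Sum>i\<in>J. a i *\<^sub>R x i)"
      by (simp add: inner_sum_right)
    finally show False by (simp add: a(1))
  qed
  moreover have "t i \<in> W i" if "i \<in> I" for i
    using that u l q by (auto simp: t_def)
  ultimately show ?thesis using that by blast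
qed

lemma unexposed_choice_exists:
  fixes W :: "'i \<Rightarrow> 'a::euclidean_space set"
  assumes "finite I" "DIM('a) \<le> card I" "2 \<le> card I"
    and W: "\<And>i. i \<in> I \<Longrightarrow> DIM('a) + 1 \<le> card (W i)"
  obtains t where "\<And>i. i \<in> I \<Longrightarrow> t i \<in> W i" "\<not> jointly_exposed I W t"
proof -
  \<comment> \<open>\<open>max\<close> adds a second index in dimension 1, where a single nonzero
    vector satisfies no nontrivial relation.\<close>
  obtain J where J: "J \<subseteq> I" "card J = max DIM('a) 2"
    using obtain_subset_with_card_n[of "max DIM('a) 2" I] assms(2,3) by auto
  then have finJ: "finite J" using assms(1) finite_subset by blast
  obtain k where k: "k \<in> J" using J(2) by fastforce
  have two: "\<exists>u l. u \<in> W i \<and> l \<in> W i \<and> l \<noteq> u" if "i \<in> I" for i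
  proof -
    have "2 \<le> card (W i)" using W[OF that] DIM_positive[where 'a='a] by linarith
    then obtain T where "T \<subseteq> W i" "card T = 2"
      using obtain_subset_with_card_n by metis
    then show ?thesis by (auto simp: card_2_iff)
  qed
  then obtain u l where ul: "\<And>i. i \<in> I \<Longrightarrow> u i \<in> W i \<and> l i \<in> W i \<and> l i \<noteq> u i"
    by metis
  \<comment> \<open>The vector \<open>y\<close> replaces the edge vector at \<open>k\<close>: it is
    positive under every functional exposing \<open>q\<close>, and with it the family still spans
    fewer than \<open>card J\<close> dimensions.\<close>
  have "\<exists>q y. q \<in> W k \<and> (\<forall>c. (\<forall>w \<in> W k - {q}. c \<bullet> w < c \<bullet> q) \<longrightarrow> 0 < c \<bullet> y)
          \<and> dim (insert y ((\<lambda>i. u i - l i) ` (J - {k}))) < card J"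
  proof (cases "DIM('a) = 1")
    case True
    have "dim (insert (u k - l k) ((\<lambda>i. u i - l i) ` (J - {k}))) \<le> 1"
      using dim_subset_UNIV True by metis
    moreover have "\<forall>c. (\<forall>w \<in> W k - {u k}. c \<bullet> w < c \<bullet> u k) \<longrightarrow> 0 < c \<bullet> (u k - l k)"
      using ul[of k] k J(1) by (auto simp: inner_diff_right)
    ultimately show ?thesis
      using ul[of k] k J True by (intro exI[of _ "u k"] exI[of _ "u k - l k"]) auto
  next
    case False
    then have d: "2 \<le> DIM('a)" using DIM_positive[where 'a='a] by linarith
    let ?E = "(\<lambda>i. u i - l i) ` (J - {k})"
    have "dim ?E \<le> card ?E" by (rule dim_le_card[OF span_superset]) (use finJ in auto)
    also have "\<dots> \<le> card (J - {k})" using finJ by (intro card_image_le) auto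
    also have "\<dots> < DIM('a)" using k finJ J d by simp
    finally obtain n where n: "n \<noteq> 0" "span ?E \<subseteq> {x. n \<bullet> x = 0}"
      using lowdim_subset_hyperplane by blast
    have "3 \<le> card (W k)" using W[of k] k J d by force
    then obtain p q m where pqm: "p \<in> W k" "q \<in> W k" "m \<in> W k" "p \<noteq> q" "m \<noteq> q"
        "n \<bullet> p \<le> n \<bullet> q" "n \<bullet> q \<le> n \<bullet> m"
      by (rule median_of_three[where f = "\<lambda>v. n \<bullet> v"])
    \<comment> \<open>The weights are crossed: \<alpha> is the height of \<open>m\<close> above
      \<open>q\<close> in direction \<open>n\<close>, \<beta> that of \<open>q\<close> above
      \<open>p\<close>, both nonnegative as \<open>q\<close> is the median. Their sum is
      \<open>n \<bullet> (m - p)\<close>; if this is 0, all three heights agree and the weights 1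
      and 0 work.\<close>
    obtain \<alpha> \<beta> :: real where ab: "0 \<le> \<alpha>" "0 \<le> \<beta>" "0 < \<alpha> + \<beta>"
        "\<alpha> * (n \<bullet> (q - p)) + \<beta> * (n \<bullet> (q - m)) = 0"
    proof (cases "n \<bullet> p = n \<bullet> m")
      case True
      then have "n \<bullet> (q - p) = 0" using pqm by (simp add: inner_diff_right)
      then show ?thesis using that[of 1 0] by simp
    next
      case False
      then show ?thesis
        using that[of "n \<bullet> (m - q)" "n \<bullet> (q - p)"] pqm
        by (auto simp: inner_diff_right algebra_simps)
    qed
    define y where "y = \<alpha> *\<^sub>R (q - p) + \<beta> *\<^sub>R (q - m)"
    have "n \<bullet> y = 0" using ab(4) by (simp add: y_def inner_add_right)
    then have "insert y ?E \<subseteq> {x. n \<bullet> x = 0}"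
      using n(2) span_superset[of ?E] by blast
    then have "dim (insert y ?E) \<le> dim {x. n \<bullet> x = 0}" by (rule dim_subset)
    also have "\<dots> < card J" using dim_hyperplane[OF n(1)] J(2) d by simp
    finally have "dim (insert y ?E) < card J" .
    moreover have "0 < c \<bullet> y" if c: "\<forall>w \<in> W k - {q}. c \<bullet> w < c \<bullet> q" for c
    proof -
      have "0 < c \<bullet> (q - p)" "0 < c \<bullet> (q - m)"
        using c pqm by (auto simp: inner_diff_right)
      then have "0 \<le> \<alpha> * (c \<bullet> (q - p))" "0 \<le> \<beta> * (c \<bullet> (q - m))"
          "0 < \<alpha> * (c \<bullet> (q - p)) \<or> 0 < \<beta> * (c \<bullet> (q - m))"
        using ab by (auto simp: zero_less_mult_iff)
      then show ?thesis
        unfolding y_def inner_add_right inner_scaleR_right by linarith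
    qed
    ultimately show ?thesis using pqm(2) by blast
  qed
  then obtain q y where q: "q \<in> W k"
    and y: "\<And>c. (\<And>w. w \<in> W k - {q} \<Longrightarrow> c \<bullet> w < c \<bullet> q) \<Longrightarrow> 0 < c \<bullet> y"
    and dim: "dim (insert y ((\<lambda>i. u i - l i) ` (J - {k}))) < card J"
    by blast
  define x where "x = (\<lambda>i. u i - l i)(k := y)"
  have "x ` J = insert y ((\<lambda>i. u i - l i) ` (J - {k}))"
    using k by (auto simp: x_def)
  then obtain a where a: "(\<Sum>i\<in>J. a i *\<^sub>R x i) = 0" "\<exists>i\<in>J. a i \<noteq> 0"
    using family_linear_relation[OF finJ, of x] dim by metis
  obtain b where b: "(\<Sum>i\<in>J. b i *\<^sub>R x i) = 0" "\<exists>i\<in>J. b i \<noteq> 0" "0 \<le> b k"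
  proof (cases "0 \<le> a k")
    case True
    then show ?thesis using that a by blast
  next
    case False
    then show ?thesis using that[of "\<lambda>i. - a i"] a by (simp add: sum_negf)
  qed
  show ?thesis
    by (rule unexposed_choice_of_relation[OF finJ J(1) k, of u W l x q b])
      (use ul J(1) q y b in \<open>auto simp: x_def intro: that\<close>)
qed

section \<open>Counting with cyclic intervals\<close>

text \<open>Number \<open>V\<close> by the residues modulo \<open>card V\<close> and let
  \<open>f j\<close> be translation by \<open>j\<close>. The first \<open>k\<close> shifts of
  \<open>v\<close> form the cyclic interval starting at \<open>v\<close>, which does not overlap
  itself as \<open>k \<le> card V\<close>.\<close>

lemma cyclic_shifts:
  assumes "finite V" "k \<le> card V"
  obtains f :: "nat \<Rightarrow> 'a \<Rightarrow> 'a" where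
    "\<And>j. j < k \<Longrightarrow> inj_on (f j) V"
    "\<And>j v. v \<in> V \<Longrightarrow> f j v \<in> V"
    "\<And>v. v \<in> V \<Longrightarrow> inj_on (\<lambda>j. f j v) {..<k}"
proof -
  let ?n = "card V"
  obtain h where h: "bij_betw h V {0..<?n}"
    using ex_bij_betw_finite_nat[OF assms(1)] by blast
  define g where "g = inv_into V h"
  have g: "bij_betw g {0..<?n} V" unfolding g_def by (rule bij_betw_inv_into[OF h])
  define f where "f = (\<lambda>j v. g ((h v + j) mod ?n))"
  have hV: "h v < ?n" if "v \<in> V" for v using h that by (auto simp: bij_betw_def)
  have g_eq: "a = b" if "g a = g b" "a < ?n" "b < ?n" for a b
    using g that by (auto simp: bij_betw_def inj_on_def)
  have lt: "m mod ?n < ?n" if "v \<in> V" for m v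
    using hV[OF that] by simp
  \<comment> \<open>With both summands below the modulus, reduction subtracts it at most once, so
    the injectivity claims become linear arithmetic.\<close>
  have mod_eq: "(a + b) mod ?n = (if a + b < ?n then a + b else a + b - ?n)"
    if "a < ?n" "b < ?n" for a b
    using that by (auto simp: le_mod_geq)
  show ?thesis
  proof (rule that[of f])
    fix j assume j: "j < k"
    show "inj_on (f j) V"
    proof (rule inj_onI)
      fix v w assume vw: "v \<in> V" "w \<in> V" "f j v = f j w"
      then have "(h v + j) mod ?n = (h w + j) mod ?n"
        by (intro g_eq lt) (auto simp: f_def)
      then have "h v = h w"
        using mod_eq[of "h v" j] mod_eq[of "h w" j] hV[OF vw(1)] hV[OF vw(2)] j assms(2)
        by (auto split: if_splits)
      then show "v = w" using h vw by (auto simp: bij_betw_def inj_on_def)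
    qed
  next
    fix j v assume "v \<in> V"
    then show "f j v \<in> V"
      using bij_betwE[OF g] lt[of v] by (simp add: f_def)
  next
    fix v assume v: "v \<in> V"
    show "inj_on (\<lambda>j. f j v) {..<k}"
    proof (rule inj_onI)
      fix i j assume ij: "i \<in> {..<k}" "j \<in> {..<k}" "f i v = f j v"
      then have "(h v + i) mod ?n = (h v + j) mod ?n"
        by (intro g_eq lt[OF v]) (auto simp: f_def)
      then show "i = j"
        using mod_eq[of "h v" i] mod_eq[of "h v" j] hV[OF v] ij assms(2)
        by (auto split: if_splits)
    qed
  qed
qed

text \<open>Each \<open>s\<close> in the product starts a box of cyclic intervals of length
  \<open>k\<close>, which contains some member of \<open>B\<close>. That member and its offsets
  \<delta> from \<open>s\<close> determine \<open>s\<close>, as each shift is injective, and there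
  are \<open>k ^ card I\<close> possible offsets.\<close>

lemma prod_card_le_of_meets_subproducts:
  fixes V :: "'i \<Rightarrow> 'a set"
  assumes "finite I" "\<And>i. i \<in> I \<Longrightarrow> finite (V i)" "\<And>i. i \<in> I \<Longrightarrow> k \<le> card (V i)"
    and "finite B"
    and B: "\<And>W. (\<And>i. i \<in> I \<Longrightarrow> W i \<subseteq> V i \<and> card (W i) = k) \<Longrightarrow> \<exists>t\<in>B. \<forall>i\<in>I. t i \<in> W i"
  shows "(\<Prod>i\<in>I. card (V i)) \<le> card B * k ^ card I"
proof -
  have "\<exists>f :: nat \<Rightarrow> 'a \<Rightarrow> 'a. (\<forall>j<k. inj_on (f j) (V i)) \<and> (\<forall>j. \<forall>v\<in>V i. f j v \<in> V i)
          \<and> (\<forall>v\<in>V i. inj_on (\<lambda>j. f j v) {..<k})" if "i \<in> I" for i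
    using cyclic_shifts[of "V i" k] assms(2,3) that by metis
  then obtain f :: "'i \<Rightarrow> nat \<Rightarrow> 'a \<Rightarrow> 'a" where
    f1: "\<And>i j. i \<in> I \<Longrightarrow> j < k \<Longrightarrow> inj_on (f i j) (V i)" and
    f2: "\<And>i j v. i \<in> I \<Longrightarrow> v \<in> V i \<Longrightarrow> f i j v \<in> V i" and
    f3: "\<And>i v. i \<in> I \<Longrightarrow> v \<in> V i \<Longrightarrow> inj_on (\<lambda>j. f i j v) {..<k}"
    by metis
  have "\<exists>t \<delta>. t \<in> B \<and> \<delta> \<in> (\<Pi>\<^sub>E i\<in>I. {..<k}) \<and> (\<forall>i\<in>I. t i = f i (\<delta> i) (s i))"
    if s: "s \<in> (\<Pi>\<^sub>E i\<in>I. V i)" for s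
  proof -
    have sV: "s i \<in> V i" if "i \<in> I" for i using s that by blast
    have "\<exists>t\<in>B. \<forall>i\<in>I. t i \<in> (\<lambda>j. f i j (s i)) ` {..<k}"
      by (rule B) (use f2 f3 sV in \<open>auto simp: card_image\<close>)
    then obtain t where t: "t \<in> B" "\<forall>i\<in>I. t i \<in> (\<lambda>j. f i j (s i)) ` {..<k}" ..
    then obtain \<delta> where "\<forall>i\<in>I. \<delta> i < k \<and> t i = f i (\<delta> i) (s i)"
      unfolding image_iff Bex_def lessThan_iff by metis
    then show ?thesis
      using t(1) by (intro exI[of _ t] exI[of _ "restrict \<delta> I"]) auto
  qed
  then obtain t \<delta> where t\<delta>: "\<And>s. s \<in> (\<Pi>\<^sub>E i\<in>I. V i) \<Longrightarrow>
      t s \<in> B \<and> \<delta> s \<in> (\<Pi>\<^sub>E i\<in>I. {..<k}) \<and> (\<forall>i\<in>I. t s i = f i (\<delta> s i) (s i))"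
    by metis
  have "inj_on (\<lambda>s. (t s, \<delta> s)) (\<Pi>\<^sub>E i\<in>I. V i)"
  proof (rule inj_onI)
    fix s s' assume ss: "s \<in> (\<Pi>\<^sub>E i\<in>I. V i)" "s' \<in> (\<Pi>\<^sub>E i\<in>I. V i)"
      and eq: "(t s, \<delta> s) = (t s', \<delta> s')"
    show "s = s'"
    proof (rule PiE_ext[OF ss])
      fix i assume i: "i \<in> I"
      have "f i (\<delta> s i) (s i) = f i (\<delta> s i) (s' i)"
        using t\<delta>[OF ss(1)] t\<delta>[OF ss(2)] eq i by auto
      moreover have "\<delta> s i < k" using t\<delta>[OF ss(1)] i by auto
      ultimately show "s i = s' i"
        using f1[OF i] ss i by (meson PiE_mem inj_onD)
    qed
  qed
  then have "card (\<Pi>\<^sub>E i\<in>I. V i) \<le> card (B \<times> (\<Pi>\<^sub>E i\<in>I. {..<k}))"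
    using t\<delta> assms(1,4) by (intro card_inj_on_le) (auto intro!: finite_PiE)
  then show ?thesis
    using assms(1) by (simp add: card_PiE card_cartesian_product)
qed

section \<open>Vertices of Minkowski sums\<close>

lemma polytope_set_sum:
  fixes P :: "'i \<Rightarrow> 'a::real_vector set"
  assumes "\<And>i. i \<in> I \<Longrightarrow> polytope (P i)"
  shows "polytope (\<Sum>i\<in>I. P i)"
proof -
  obtain S where S: "\<And>i. i \<in> I \<Longrightarrow> finite (S i) \<and> P i = convex hull (S i)"
    using assms unfolding polytope_def by metis
  have "finite (\<Sum>i\<in>I. S i)"
    using S by (induction I rule: infinite_finite_induct) (auto intro: finite_set_plus)
  moreover have "(\<Sum>i\<in>I. P i) = convex hull (\<Sum>i\<in>I. S i)"
    using S by (simp add: convex_hull_set_sum)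
  ultimately show ?thesis unfolding polytope_def by blast
qed

text \<open>A vertex \<open>v\<close> of a polytope is exposed by some functional. Replacing one
  summand \<open>s i\<close> by \<open>w\<close> moves the sum by \<open>w - s i\<close>, so strict
  maximality at \<open>v\<close> passes to every \<open>s i\<close> in \<open>P i\<close>.\<close>

lemma extreme_point_of_set_sum:
  fixes P :: "'i \<Rightarrow> 'a::euclidean_space set"
  assumes "finite I" "\<And>i. i \<in> I \<Longrightarrow> polytope (P i)" "v extreme_point_of (\<Sum>i\<in>I. P i)"
  obtains t where "t \<in> (\<Pi>\<^sub>E i\<in>I. {w. w extreme_point_of P i})" "jointly_exposed I P t"
    "v = (\<Sum>i\<in>I. t i)"
proof -
  let ?S = "\<Sum>i\<in>I. P i"
  \<comment> \<open>Extreme points of a general convex set need not be exposed; those of a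
    polyhedron are.\<close>
  have "polyhedron ?S"
    using polytope_set_sum[of I P] assms(2) polytope_imp_polyhedron by blast
  then have "{v} exposed_face_of ?S"
    using assms(3) by (simp add: exposed_face_of_polyhedron face_of_singleton)
  then obtain a b where ab: "?S \<subseteq> {x. a \<bullet> x \<le> b}" "{v} = ?S \<inter> {x. a \<bullet> x = b}"
    unfolding exposed_face_of_def by blast
  then have max: "a \<bullet> x < a \<bullet> v" if "x \<in> ?S" "x \<noteq> v" for x
  proof -
    have "a \<bullet> v = b" "a \<bullet> x \<le> b" "a \<bullet> x \<noteq> b" using ab that by blast+
    then show ?thesis by simp
  qed
  have "v \<in> ?S" using ab(2) by blast
  then obtain s where s: "v = sum s I" "\<forall>i\<in>I. s i \<in> P i"
    unfolding set_sum_alt[OF assms(1)] by blast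
  have strict: "a \<bullet> w < a \<bullet> s i" if i: "i \<in> I" "w \<in> P i - {s i}" for i w
  proof -
    have eq: "sum (s(i := w)) I = v + (w - s i)"
      using sum.remove[OF assms(1) i(1), of "s(i := w)"] sum.remove[OF assms(1) i(1), of s] s(1)
      by simp
    have "\<forall>j\<in>I. (s(i := w)) j \<in> P j" using i s(2) by auto
    then have "sum (s(i := w)) I \<in> ?S"
      unfolding set_sum_alt[OF assms(1)] by blast
    moreover have "v + (w - s i) \<noteq> v" using i by simp
    ultimately have "a \<bullet> (v + (w - s i)) < a \<bullet> v" using max eq by metis
    then show ?thesis by (simp add: inner_add_right inner_diff_right)
  qed
  have "s i extreme_point_of P i" if "i \<in> I" for i
    by (rule extreme_point_of_Int_supporting_hyperplane_le[of _ a "a \<bullet> s i"])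
      (use strict[OF that] s(2) that in \<open>force+\<close>)
  moreover have "jointly_exposed I P (restrict s I)"
    unfolding jointly_exposed_def using strict by (intro exI[of _ a]) auto
  ultimately show ?thesis
    using that[of "restrict s I"] s(1) by auto
qed

theorem theorem1p3:
  fixes P :: "nat \<Rightarrow> (real^'d) set" and r :: nat
  assumes "CARD('d) \<ge> 1"
    and "r \<ge> CARD('d)"
    and "\<not> (CARD('d) = 1 \<and> r = 1)"
    and "\<And>i. i \<in> {1..r} \<Longrightarrow> polytope (P i)"
    and "\<And>i. i \<in> {1..r} \<Longrightarrow> f0 (P i) \<ge> CARD('d) + 1"
  shows "real (f0 (\<Sum>i=1..r. P i))
           \<le> (1 - 1 / (real CARD('d) + 1) ^ r) * (\<Prod>i=1..r. real (f0 (P i)))"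
proof -
  define I where "I = {1..r}"
  define V where "V = (\<lambda>i. {w. w extreme_point_of P i})"
  define T where "T = (\<Pi>\<^sub>E i\<in>I. V i)"
  define G where "G = {t \<in> T. jointly_exposed I V t}"
  define k where "k = CARD('d) + 1"
  have I: "finite I" "card I = r" by (auto simp: I_def)
  have f0_V: "f0 (P i) = card (V i)" for i by (simp add: f0_def V_def)
  have Vk: "k \<le> card (V i)" if "i \<in> I" for i
    using assms(5)[of i] that by (simp add: k_def I_def f0_V)
  \<comment> \<open>An infinite set would have \<open>card\<close> equal to 0, below
    \<open>k\<close>.\<close>
  then have finV: "finite (V i)" if "i \<in> I" for i
    using that by (metis card.infinite add_is_0 k_def le_zero_eq one_neq_zero)
  have finT: "finite T" unfolding T_def using I finV by (auto intro: finite_PiE)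
  have cardT: "card T = (\<Prod>i\<in>I. card (V i))" unfolding T_def using I by (simp add: card_PiE)
  have VP: "V i \<subseteq> P i" for i by (auto simp: V_def extreme_point_of_def)

  have "{v. v extreme_point_of (\<Sum>i\<in>I. P i)} \<subseteq> (\<lambda>t. \<Sum>i\<in>I. t i) ` G"
  proof
    fix v assume "v \<in> {v. v extreme_point_of (\<Sum>i\<in>I. P i)}"
    then obtain t where t: "t \<in> T" "jointly_exposed I P t" "v = (\<Sum>i\<in>I. t i)"
      using extreme_point_of_set_sum[of I P v] I assms(4) unfolding T_def V_def I_def by auto
    then show "v \<in> (\<lambda>t. \<Sum>i\<in>I. t i) ` G"
      using jointly_exposed_mono[OF t(2) VP] by (auto simp: G_def)
  qed
  then have upper: "f0 (\<Sum>i\<in>I. P i) \<le> card G"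
    unfolding f0_def using finT by (intro surj_card_le) (auto simp: G_def)

  \<comment> \<open>The choices outside \<open>G\<close> meet every product of
    \<open>k\<close>-subsets, so they make up at least a \<open>1 / k ^ r\<close> share of all
    choices.\<close>
  have "card T \<le> card (T - G) * k ^ card I"
    unfolding cardT
  proof (rule prod_card_le_of_meets_subproducts)
    fix W assume W: "\<And>i. i \<in> I \<Longrightarrow> W i \<subseteq> V i \<and> card (W i) = k"
    \<comment> \<open>In dimension 1 this is exactly the excluded case \<open>r = 1\<close>.\<close>
    have "2 \<le> r"
      using assms(1-3) by linarith
    then obtain t where t: "\<And>i. i \<in> I \<Longrightarrow> t i \<in> W i" "\<not> jointly_exposed I W t"
      using unexposed_choice_exists[of I W] I assms(2) W by (auto simp: k_def)
    \<comment> \<open>Members of \<open>T\<close> are extensional, hence the restriction. A choice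
      not exposed among the smaller \<open>W i\<close> is not exposed among the \<open>V i\<close>
      either.\<close>
    have "\<not> jointly_exposed I W (restrict t I)"
      using t(2) by (simp add: jointly_exposed_def)
    then have "\<not> jointly_exposed I V (restrict t I)"
      using jointly_exposed_mono W by blast
    then show "\<exists>t\<in>T - G. \<forall>i\<in>I. t i \<in> W i"
      using t(1) W by (intro bexI[of _ "restrict t I"]) (auto simp: T_def G_def)
  qed (use I finV Vk finT in auto)
  moreover have "card (T - G) = card T - card G" "card G \<le> card T"
    using finT by (auto simp: G_def intro: card_Diff_subset card_mono)
  ultimately have "real (card T) \<le> (real (card T) - real (card G)) * real k ^ r"
    using I(2) by (metis of_nat_diff of_nat_le_iff of_nat_mult of_nat_power)
  then have "real (card G) \<le> (1 - 1 / real k ^ r) * real (card T)"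
    by (simp add: k_def field_simps)
  then show ?thesis
    using upper unfolding cardT I_def f0_V k_def by (simp add: add.commute)
qed

end
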